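(* Let $\mathscr{F}\subseteq\mathscr{P}(\omega)$ be a nonempty $\omega$-closed family with $\varnothing\notin\mathscr{F}$. Then the semigroup $\boldsymbol{B}_{\omega}^{\mathscr{F}}$ is simple if and only if for all $F_1,F_2\in\mathscr{F}$ there exist $k_1,k_2\in\omega$ such that $F_1\subseteq -k_1+F_2$ and $F_2\subseteq -k_2+F_1$.
   Context: $\omega$ is the set of non-negative integers, $\mathscr{P}(\omega)$ its power set. For an integer $n$ and $F\subseteq\omega$ put $n+F=\{n+k\colon k\in F\}\subseteq\mathbb{Z}$ (empty if $F=\varnothing$). A family $\mathscr{F}\subseteq\mathscr{P}(\omega)$ is $\omega$-closed if $F_1\cap(-n+F_2)\in\mathscr{F}$ for all $n\in\omega$ and $F_1,F_2\in\mathscr{F}$. For an $\omega$-closed family $\mathscr{F}$ with $\varnothing\notin\mathscr{F}$, $\boldsymbol{B}_{\omega}^{\mathscr{F}}$ is the set $\boldsymbol{B}_{\omega}\times\mathscr{F}=\omega\times\omega\times\mathscr{F}$ with the semigroup operation $$(i_1,j_1,F_1)\cdot(i_2,j_2,F_2)=\begin{cases}(i_1-j_1+i_2,\,j_2,\,(j_1-i_2+F_1)\cap F_2), & j_1\leqslant i_2;\\ (i_1,\,j_1-i_2+j_2,\,F_1\cap(i_2-j_1+F_2)), & j_1\geqslant i_2.\end{cases}$$ A semigroup is simple if it has no proper two-sided ideals, i.e. it consists of a single $\mathscr{J}$-class. *)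

theory Defs
  imports Main
begin

definition two_sided_ideal :: "'a set \<Rightarrow> ('a \<Rightarrow> 'a \<Rightarrow> 'a) \<Rightarrow> 'a set \<Rightarrow> bool" where
  "two_sided_ideal S f I \<longleftrightarrow>
     I \<noteq> {} \<and> I \<subseteq> S \<and> (\<forall>x\<in>S. \<forall>a\<in>I. f x a \<in> I \<and> f a x \<in> I)"

definition is_semigroup :: "'a set \<Rightarrow> ('a \<Rightarrow> 'a \<Rightarrow> 'a) \<Rightarrow> bool" where
  "is_semigroup S f \<longleftrightarrow>
     S \<noteq> {} \<and> (\<forall>x\<in>S. \<forall>y\<in>S. f x y \<in> S) \<and>
     (\<forall>x\<in>S. \<forall>y\<in>S. \<forall>z\<in>S. f (f x y) z = f x (f y z))"

definition simple_semigroup :: "'a set \<Rightarrow> ('a \<Rightarrow> 'a \<Rightarrow> 'a) \<Rightarrow> bool" where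
  "simple_semigroup S f \<longleftrightarrow>
     is_semigroup S f \<and> (\<forall>I. two_sided_ideal S f I \<longrightarrow> I = S)"

definition translate :: "int \<Rightarrow> nat set \<Rightarrow> int set" where
  "translate n F = {n + int k | k. k \<in> F}"

text \<open>Translates live in the integers, members of a family in the naturals. A subset of the
  integers is intersected with a set of naturals by pulling it back along the inclusion
  \<open>int\<close>.\<close>

definition omega_closed :: "nat set set \<Rightarrow> bool" where
  "omega_closed \<F> \<longleftrightarrow>
     (\<forall>n::nat. \<forall>F1\<in>\<F>. \<forall>F2\<in>\<F>. F1 \<inter> (int -` translate (- int n) F2) \<in> \<F>)"

type_synonym bext = "nat \<times> nat \<times> nat set"

definition bext_carrier :: "nat set set \<Rightarrow> bext set" where
  "bext_carrier \<F> = UNIV \<times> UNIV \<times> \<F>"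

text \<open>In the first coordinate \<open>i1 - j1 + i2\<close> is an integer expression; it is reordered below so
  that the subtraction of naturals does not truncate.\<close>

fun bext_mult :: "bext \<Rightarrow> bext \<Rightarrow> bext" where
  "bext_mult (i1, j1, F1) (i2, j2, F2) =
     (if j1 \<le> i2
      then (i1 + i2 - j1, j2, (int -` translate (int j1 - int i2) F1) \<inter> F2)
      else (i1, j1 + j2 - i2, F1 \<inter> (int -` translate (int i2 - int j1) F2)))"

lemma bext_mult_ge:
  assumes "j1 \<ge> i2"
  shows "bext_mult (i1, j1, F1) (i2, j2, F2) =
    (i1, j1 + j2 - i2, F1 \<inter> (int -` translate (int i2 - int j1) F2))"
proof (cases "j1 = i2")
  case True
  then show ?thesis by (auto simp: translate_def)
next
  case False
  then show ?thesis using assms by simp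
qed

lemma vimage_translate:
  "k \<in> int -` translate n F \<longleftrightarrow> int k \<ge> n \<and> nat (int k - n) \<in> F"
proof
  assume "k \<in> int -` translate n F"
  then obtain m where "int k = n + int m" "m \<in> F" by (auto simp: translate_def)
  then show "int k \<ge> n \<and> nat (int k - n) \<in> F" by simp
next
  assume "int k \<ge> n \<and> nat (int k - n) \<in> F"
  moreover from this have "int k = n + int (nat (int k - n))" by simp
  ultimately show "k \<in> int -` translate n F"
    unfolding translate_def by blast
qed

lemma vimage_translate_neg:
  assumes "a \<le> b"
  shows "int -` translate (int a - int b) F = {k. k + (b - a) \<in> F}"
proof -
  have "nat (int k - (int a - int b)) = k + (b - a)" for k
    using assms by linarith
  then show ?thesis using assms by (auto simp: set_eq_iff vimage_translate simp del: vimage_eq)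
qed

lemma bext_mult_le':
  "j1 \<le> i2 \<Longrightarrow> bext_mult (i1, j1, F1) (i2, j2, F2) =
     (i1 + i2 - j1, j2, {k. k + (i2 - j1) \<in> F1} \<inter> F2)"
  by (simp add: vimage_translate_neg)

lemma bext_mult_ge':
  "j1 \<ge> i2 \<Longrightarrow> bext_mult (i1, j1, F1) (i2, j2, F2) =
     (i1, j1 + j2 - i2, F1 \<inter> {k. k + (j1 - i2) \<in> F2})"
  by (simp only: bext_mult_ge vimage_translate_neg)

lemma bext_mult_assoc:
  "bext_mult (bext_mult x y) z = bext_mult x (bext_mult y z)"
proof -
  obtain i1 j1 F1 i2 j2 F2 i3 j3 F3
    where [simp]: "x = (i1, j1, F1)" "y = (i2, j2, F2)" "z = (i3, j3, F3)"
    by (metis prod_cases3)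
  have s: "bext_mult (i1, j1, F1) (i2, j2, F2) =
     (if j1 \<le> i2 then (i1 + i2 - j1, j2, {k. k + (i2 - j1) \<in> F1} \<inter> F2)
      else (i1, j1 + j2 - i2, F1 \<inter> {k. k + (j1 - i2) \<in> F2}))" for i1 j1 F1 i2 j2 F2
    using bext_mult_le'[of j1 i2] bext_mult_ge'[of i2 j1] by (metis nle_le)
  show ?thesis
    by (cases "j1 \<le> i2"; cases "j2 \<le> i3"; cases "j1 + j2 \<le> i2 + i3")
      (auto simp: s ac_simps simp del: bext_mult.simps)
qed

lemma is_semigroup_bext:
  assumes "omega_closed \<F>" "\<F> \<noteq> {}"
  shows "is_semigroup (bext_carrier \<F>) bext_mult"
proof -
  have c: "F1 \<inter> {k. k + n \<in> F2} \<in> \<F>" if "F1 \<in> \<F>" "F2 \<in> \<F>" for F1 F2 n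
  proof -
    have "F1 \<inter> (int -` translate (- int n) F2) \<in> \<F>"
      using assms(1) that by (simp add: omega_closed_def)
    then show ?thesis using vimage_translate_neg[of 0 n F2] by simp
  qed
  have "bext_mult x y \<in> bext_carrier \<F>"
    if "x \<in> bext_carrier \<F>" "y \<in> bext_carrier \<F>" for x y
  proof -
    obtain i1 j1 F1 i2 j2 F2 where [simp]: "x = (i1, j1, F1)" "y = (i2, j2, F2)"
      by (metis prod_cases3)
    have F: "F1 \<in> \<F>" "F2 \<in> \<F>" using that by (auto simp: bext_carrier_def)
    show ?thesis
    proof (cases "j1 \<le> i2")
      case True
      then show ?thesis using c[OF F(2,1), of "i2 - j1"]
        by (simp only: bext_mult_le' \<open>x = _\<close> \<open>y = _\<close>) (auto simp: bext_carrier_def Int_commute)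
    next
      case False
      then have "i2 \<le> j1" by simp
      then show ?thesis using c[OF F, of "j1 - i2"]
        by (simp only: bext_mult_ge' \<open>x = _\<close> \<open>y = _\<close>) (auto simp: bext_carrier_def)
    qed
  qed
  moreover have "bext_carrier \<F> \<noteq> {}" using assms(2) by (auto simp: bext_carrier_def)
  ultimately show ?thesis by (simp add: is_semigroup_def bext_mult_assoc)
qed

end

theory Submission
  imports Defs
begin

text \<open>Say that \<open>F\<close> shifts into \<open>G\<close> if some translate \<open>k + F\<close> with \<open>k \<ge> 0\<close> is contained in \<open>G\<close>;
  this is a preorder, and the condition of the theorem says that any two members of \<open>\<F>\<close> are
  equivalent for it.

  The set in the third coordinate of a product is an intersection of the two sets involved, one
  of them pulled back by a non-negative amount, so it shifts into both of them
  (\<open>shifts_into_bext_mult\<close>). Hence the triples whose set shifts into a fixed \<open>G\<close> form an ideal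
  (\<open>two_sided_ideal_shifts_into\<close>), and in a simple semigroup this ideal must be everything.

  Conversely, if \<open>k + G \<subseteq> F\<close>, then multiplying \<open>(i, j, F)\<close> from the left by a triple with set
  \<open>G\<close> whose second coordinate exceeds \<open>i\<close> by exactly \<open>k\<close> intersects \<open>G\<close> with a superset of
  \<open>G\<close>. In this way the set \<open>F\<close> is replaced by \<open>G\<close>, and the outer coordinates are adjusted as in
  the bicyclic monoid (\<open>bext_mult_factor\<close>). So any ideal that contains \<open>(i, j, F)\<close> contains all
  triples with set \<open>G\<close>.\<close>

definition shifts_into :: "nat set \<Rightarrow> nat set \<Rightarrow> bool" where
  "shifts_into F G \<longleftrightarrow> (\<exists>k. \<forall>x\<in>F. x + k \<in> G)"

lemma image_int_subset_translate_iff: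
  "int ` F \<subseteq> translate (- int k) G \<longleftrightarrow> (\<forall>x\<in>F. x + k \<in> G)"
proof -
  have "int ` F \<subseteq> translate (- int k) G \<longleftrightarrow> F \<subseteq> int -` translate (int 0 - int k) G"
    by auto
  also have "\<dots> \<longleftrightarrow> (\<forall>x\<in>F. x + k \<in> G)"
    by (subst vimage_translate_neg) auto
  finally show ?thesis .
qed

lemma shifts_into_refl: "shifts_into F F"
  unfolding shifts_into_def by (intro exI[of _ 0]) simp

lemma shifts_into_trans:
  assumes "shifts_into F G" "shifts_into G H"
  shows "shifts_into F H"
proof -
  obtain k l where "\<forall>x\<in>F. x + k \<in> G" "\<forall>x\<in>G. x + l \<in> H"
    using assms unfolding shifts_into_def by blast
  then have "\<forall>x\<in>F. x + (k + l) \<in> H"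
    by (simp add: add.assoc[symmetric])
  then show ?thesis unfolding shifts_into_def by blast
qed

text \<open>In both cases of the multiplication the set that is translated is moved to the left, that
  is, pulled back along \<open>x \<mapsto> x + n\<close> for a natural number \<open>n\<close>. A point of the product therefore
  lies in one factor and reaches the other one after adding \<open>n\<close>.\<close>

lemma shifts_into_bext_mult:
  assumes "bext_mult (i1, j1, F1) (i2, j2, F2) = (i, j, F)"
  shows "shifts_into F F1" "shifts_into F F2"
proof -
  have "shifts_into F F1 \<and> shifts_into F F2"
  proof (cases "j1 \<le> i2")
    case True
    then have F: "F = {x. x + (i2 - j1) \<in> F1} \<inter> F2"
      using assms bext_mult_le' by simp
    have "\<forall>x\<in>F. x + (i2 - j1) \<in> F1" "\<forall>x\<in>F. x + 0 \<in> F2"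
      unfolding F by auto
    then show ?thesis unfolding shifts_into_def by blast
  next
    case False
    then have "F = F1 \<inter> {x. x + (j1 - i2) \<in> F2}"
      using assms bext_mult_ge'[of i2 j1] by (metis nat_le_linear prod.inject)
    then have "\<forall>x\<in>F. x + 0 \<in> F1" "\<forall>x\<in>F. x + (j1 - i2) \<in> F2" by auto
    then show ?thesis unfolding shifts_into_def by blast
  qed
  then show "shifts_into F F1" "shifts_into F F2" by auto
qed

lemma two_sided_ideal_shifts_into:
  assumes "omega_closed \<F>" "G \<in> \<F>"
  shows "two_sided_ideal (bext_carrier \<F>) bext_mult
    {(i, j, F) | i j F. F \<in> \<F> \<and> shifts_into F G}" (is "two_sided_ideal ?S _ ?I")
proof -
  have closed: "bext_mult x y \<in> ?S" if "x \<in> ?S" "y \<in> ?S" for x y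
    using is_semigroup_bext[of \<F>] assms that by (auto simp: is_semigroup_def)
  have "bext_mult x a \<in> ?I \<and> bext_mult a x \<in> ?I" if x: "x \<in> ?S" and a: "a \<in> ?I" for x a
  proof -
    obtain i j F where a_eq: "a = (i, j, F)" and F: "F \<in> \<F>" "shifts_into F G"
      using a by blast
    obtain i' j' F' where x_eq: "x = (i', j', F')" by (rule prod_cases3)
    have aS: "a \<in> ?S" using a_eq F by (simp add: bext_carrier_def)
    obtain p q H where xa: "bext_mult x a = (p, q, H)" by (rule prod_cases3)
    obtain p' q' H' where ax: "bext_mult a x = (p', q', H')" by (rule prod_cases3)
    have "shifts_into H F" "shifts_into H' F"
      using shifts_into_bext_mult xa ax unfolding x_eq a_eq by blast+
    then have "shifts_into H G" "shifts_into H' G"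
      using F(2) shifts_into_trans by blast+
    moreover have "H \<in> \<F>" "H' \<in> \<F>"
      using closed[OF x aS] closed[OF aS x] xa ax by (simp_all add: bext_carrier_def)
    ultimately show ?thesis using xa ax by simp
  qed
  moreover have "(0, 0, G) \<in> ?I" using assms(2) shifts_into_refl by simp
  moreover have "?I \<subseteq> ?S" by (auto simp: bext_carrier_def)
  ultimately show ?thesis unfolding two_sided_ideal_def by blast
qed

text \<open>The middle coordinate \<open>i + k\<close> is chosen so that \<open>F\<close> is pulled back by exactly \<open>k\<close>. The left
  product is then \<open>(a, j + k, G)\<close>, and the right factor matches its second coordinate, so that
  \<open>G\<close> is met with itself without any shift.\<close>

lemma bext_mult_factor:
  assumes "\<forall>x\<in>G. x + k \<in> F"
  shows "bext_mult (bext_mult (a, i + k, G) (i, j, F)) (j + k, b, G) = (a, b, G)"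
proof -
  have "bext_mult (a, i + k, G) (i, j, F) = (a, j + k, G \<inter> {x. x + k \<in> F})"
    by (subst bext_mult_ge') auto
  also have "G \<inter> {x. x + k \<in> F} = G" using assms by auto
  finally show ?thesis by (simp only: bext_mult_le'[OF order_refl]) auto
qed

theorem mainTheorem6:
  fixes \<F> :: "nat set set"
  assumes "\<F> \<noteq> {}" and "omega_closed \<F>" and "{} \<notin> \<F>"
  shows "simple_semigroup (bext_carrier \<F>) bext_mult \<longleftrightarrow>
    (\<forall>F1\<in>\<F>. \<forall>F2\<in>\<F>. \<exists>k1 k2 :: nat.
       int ` F1 \<subseteq> translate (- int k1) F2 \<and> int ` F2 \<subseteq> translate (- int k2) F1)"
proof -
  let ?S = "bext_carrier \<F>"
  have "simple_semigroup ?S bext_mult \<longleftrightarrow> (\<forall>F\<in>\<F>. \<forall>G\<in>\<F>. shifts_into F G)"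
  proof
    assume simple: "simple_semigroup ?S bext_mult"
    show "\<forall>F\<in>\<F>. \<forall>G\<in>\<F>. shifts_into F G"
    proof (intro ballI)
      fix F G assume FG: "F \<in> \<F>" "G \<in> \<F>"
      have "{(i, j, F) | i j F. F \<in> \<F> \<and> shifts_into F G} = ?S"
        using simple two_sided_ideal_shifts_into[OF assms(2) FG(2)]
        unfolding simple_semigroup_def by blast
      moreover have "(0, 0, F) \<in> ?S" using FG(1) by (simp add: bext_carrier_def)
      ultimately show "shifts_into F G" by blast
    qed
  next
    assume shifts: "\<forall>F\<in>\<F>. \<forall>G\<in>\<F>. shifts_into F G"
    have "I = ?S" if I: "two_sided_ideal ?S bext_mult I" for I
    proof
      show "I \<subseteq> ?S" using I by (simp add: two_sided_ideal_def)
      show "?S \<subseteq> I"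
      proof
        fix s assume "s \<in> ?S"
        then obtain a b G where s: "s = (a, b, G)" "G \<in> \<F>"
          by (auto simp: bext_carrier_def)
        obtain i j F where F: "(i, j, F) \<in> I" "F \<in> \<F>"
          using I unfolding two_sided_ideal_def bext_carrier_def by blast
        obtain k where k: "\<forall>x\<in>G. x + k \<in> F"
          using shifts s(2) F(2) unfolding shifts_into_def by blast
        have "(a, i + k, G) \<in> ?S" "(j + k, b, G) \<in> ?S"
          using s(2) by (simp_all add: bext_carrier_def)
        then have "bext_mult (bext_mult (a, i + k, G) (i, j, F)) (j + k, b, G) \<in> I"
          using I F(1) unfolding two_sided_ideal_def by blast
        then show "s \<in> I" using bext_mult_factor[OF k] s(1) by simp
      qed
    qed
    then show "simple_semigroup ?S bext_mult"
      using is_semigroup_bext[OF assms(2,1)] by (simp add: simple_semigroup_def)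
  qed
  also have "\<dots> \<longleftrightarrow> (\<forall>F1\<in>\<F>. \<forall>F2\<in>\<F>. shifts_into F1 F2 \<and> shifts_into F2 F1)"
    by blast
  also have "\<dots> \<longleftrightarrow> (\<forall>F1\<in>\<F>. \<forall>F2\<in>\<F>. \<exists>k1 k2 :: nat.
      int ` F1 \<subseteq> translate (- int k1) F2 \<and> int ` F2 \<subseteq> translate (- int k2) F1)"
    by (simp add: image_int_subset_translate_iff shifts_into_def)
  finally show ?thesis .
qed

end
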